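(* Let $\mathcal{K}\subset\mathbb{R}^n$ be a bounded convex set with nonempty interior and let $\hat\theta\in\mathbb{R}^n$. Then the central path over $\mathcal{K}$ corresponding to the entropic barrier $A^*_-$ is the same as the heat path over $\mathcal{K}$, i.e. $$\bigcup_{t>0}\left\{\mathbb{E}_{x\sim P_{\hat\theta/t}}[x]\right\}=\bigcup_{t>0}\left\{\arg\min_{x\in\mathrm{int}(\mathcal{K})}\left\{t\,\hat\theta^\top x+A^*_-(x)\right\}\right\}.$$
   Context: For $\theta\in\mathbb{R}^n$, $P_\theta$ is the probability distribution on $\mathcal{K}$ with density $P_\theta(x)=\exp(-\theta^\top x-A(\theta))$, where $A(\theta)=\log\int_{\mathcal{K}}\exp(-\theta^\top x')\,dx'$. The Fenchel conjugate of $A$ is $A^*(x)=\sup_{\theta\in\mathbb{R}^n}\{\theta^\top x-A(\theta)\}$, whose domain is taken to be $\mathrm{int}(-\mathcal{K})$, and the entropic barrier is $A^*_-(x)=A^*(-x)$, with domain $\mathrm{int}(\mathcal{K})$. The heat path for objective $\hat\theta$ is the set of points $\mathbb{E}_{x\sim P_{\hat\theta/t}}[x]$ as the temperature $t$ varies; the central path for a barrier function $\varphi$ is the set of points $\arg\min_{x}\{t\,\hat\theta^\top x+\varphi(x)\}$ as $t$ varies. *)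

theory Defs
  imports "HOL-Analysis.Analysis"
begin

text \<open>
  A convex set is Lebesgue measurable but need not be Borel, so the reference measure is
  \<open>lebesgue_on K\<close> rather than a restriction of \<open>lborel\<close>.
\<close>

definition log_partition :: "(real ^ 'n) set \<Rightarrow> real ^ 'n \<Rightarrow> real" where
  "log_partition K \<theta> = ln (\<integral>x. exp (- (\<theta> \<bullet> x)) \<partial>lebesgue_on K)"

definition exp_family :: "(real ^ 'n) set \<Rightarrow> real ^ 'n \<Rightarrow> (real ^ 'n) measure" where
  "exp_family K \<theta> =
     density (lebesgue_on K) (\<lambda>x. ennreal (exp (- (\<theta> \<bullet> x) - log_partition K \<theta>)))"

definition fenchel_conjugate :: "(real ^ 'n \<Rightarrow> real) \<Rightarrow> real ^ 'n \<Rightarrow> ereal" where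
  "fenchel_conjugate f x = (SUP \<theta>. ereal (\<theta> \<bullet> x - f \<theta>))"

text \<open>
  Restricting a function to an effective domain is expressed by the value \<open>\<infinity>\<close> outside that domain.
\<close>

definition log_partition_conjugate :: "(real ^ 'n) set \<Rightarrow> real ^ 'n \<Rightarrow> ereal" where
  "log_partition_conjugate K x =
     (if x \<in> interior (uminus ` K) then fenchel_conjugate (log_partition K) x else \<infinity>)"

definition entropic_barrier :: "(real ^ 'n) set \<Rightarrow> real ^ 'n \<Rightarrow> ereal" where
  "entropic_barrier K x = log_partition_conjugate K (- x)"

definition central_objective ::
  "(real ^ 'n \<Rightarrow> ereal) \<Rightarrow> real ^ 'n \<Rightarrow> real \<Rightarrow> real ^ 'n \<Rightarrow> ereal" where
  "central_objective \<phi> \<theta> t x = ereal (t * (\<theta> \<bullet> x)) + \<phi> x"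

definition central_path ::
  "(real ^ 'n) set \<Rightarrow> (real ^ 'n \<Rightarrow> ereal) \<Rightarrow> real ^ 'n \<Rightarrow> (real ^ 'n) set" where
  "central_path K \<phi> \<theta> =
     (\<Union>t\<in>{0<..}. {arg_min (central_objective \<phi> \<theta> t) (\<lambda>x. x \<in> interior K)})"

definition heat_path :: "(real ^ 'n) set \<Rightarrow> real ^ 'n \<Rightarrow> (real ^ 'n) set" where
  "heat_path K \<theta> = (\<Union>t\<in>{0<..}. {\<integral>x. x \<partial>exp_family K (\<theta> /\<^sub>R t)})"

end

theory Submission
  imports Defs
begin

text \<open>
  Fix \<open>t > 0\<close> and put \<open>\<eta> = t \<theta>\<close>.  Choosing the single competitor \<open>\<eta>\<close> in the supremum that defines
  the entropic barrier gives \<open>\<eta> \<bullet> x + A\<^sup>*(- x) \<ge> - A(\<eta>)\<close> for every interior \<open>x\<close>: the Fenchel--Young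
  inequality.  Hence any interior point with equality minimises the central objective, and the
  theorem amounts to the claim that equality holds exactly at the mean \<open>m\<close> of \<open>P\<^sub>\<eta>\<close>; the
  temperature of the heat path is then the reciprocal of the parameter of the central path.

  Equality at \<open>x\<close> says that \<open>- x\<close> is a subgradient of \<open>A\<close> at \<open>\<eta>\<close>.  No differentiation under the
  integral is needed, because increments of \<open>A\<close> are exponential moments: for every \<open>w\<close> and \<open>c\<close>,
  the expectation of \<open>exp (- w \<bullet> (X - c))\<close> under \<open>P\<^sub>\<eta>\<close> is \<open>exp (A(\<eta> + w) - A(\<eta>) + w \<bullet> c)\<close>
  (\<open>exp_family_moment\<close>).  With \<open>c = m\<close>, the inequality \<open>1 + y \<le> exp y\<close> shows that \<open>- m\<close> is a
  subgradient (\<open>mean_subgradient\<close>).  With \<open>c = x\<close> and small \<open>w\<close> in the direction \<open>m - x\<close>, a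
  quadratic upper bound for the exponential shows that \<open>- x\<close> is a subgradient only if \<open>x = m\<close>
  (\<open>subgradient_unique\<close>).  Finally \<open>m\<close> lies in the interior of \<open>K\<close> (\<open>mean_in_interior\<close>), since
  otherwise a hyperplane would separate \<open>m\<close> from \<open>K\<close>, which is impossible for the mean of a
  positive density on a body of full dimension.
\<close>

section \<open>Exponential bound and integrals over bounded sets\<close>

text \<open>Obtained by inverting \<open>1 - y \<le> exp (- y)\<close> and estimating the geometric series \<open>1 / (1 - y)\<close>.\<close>

lemma exp_le_quadratic:
  fixes y :: real
  assumes "y \<le> 1/2"
  shows "exp y \<le> 1 + y + 2 * y\<^sup>2"
proof -
  have "1 - y \<le> exp (- y)"
    using exp_ge_add_one_self[of "- y"] by simp
  then have "exp y * (1 - y) \<le> exp y * exp (- y)"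
    by (intro mult_left_mono) auto
  then have "exp y * (1 - y) \<le> 1"
    by (simp add: exp_minus)
  also have "1 \<le> (1 + y + 2 * y\<^sup>2) * (1 - y)"
  proof -
    have "(1 + y + 2 * y\<^sup>2) * (1 - y) - 1 = y\<^sup>2 * (1 - 2 * y)"
      by (simp add: algebra_simps power2_eq_square)
    moreover have "0 \<le> y\<^sup>2 * (1 - 2 * y)"
      using assms by (intro mult_nonneg_nonneg) auto
    ultimately show ?thesis by linarith
  qed
  finally show ?thesis
    using assms by simp
qed

lemma integrable_continuous_lebesgue_on:
  fixes f :: "'a::euclidean_space \<Rightarrow> 'b::{banach, second_countable_topology}"
  assumes "bounded K" "K \<in> lmeasurable" "continuous_on UNIV f"
  shows "integrable (lebesgue_on K) f"
proof -
  interpret finite_measure "lebesgue_on K"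
    by (rule finite_measure_lebesgue_on[OF assms(2)])
  have "compact (f ` closure K)"
    using assms by (intro compact_continuous_image continuous_on_subset[OF assms(3)]) auto
  then obtain B where B: "\<And>x. x \<in> closure K \<Longrightarrow> norm (f x) \<le> B"
    using compact_imp_bounded bounded_iff by (metis imageI)
  have "f \<in> borel_measurable (lebesgue_on K)"
    using assms by (intro continuous_imp_measurable_on_sets_lebesgue continuous_on_subset[OF assms(3)]) auto
  moreover have "AE x in lebesgue_on K. norm (f x) \<le> B"
    using B closure_subset[of K] by (intro AE_I2) (auto simp: space_restrict_space)
  ultimately show ?thesis
    by (intro integrable_const_bound)
qed

text \<open>
  A continuous function that vanishes almost everywhere on \<open>K\<close> vanishes on the interior, because
  nonempty open sets are not negligible.
\<close>

lemma integral_lebesgue_on_pos: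
  fixes f :: "'a::euclidean_space \<Rightarrow> real"
  assumes "bounded K" "K \<in> lmeasurable" "continuous_on UNIV f"
    and nonneg: "\<And>x. x \<in> K \<Longrightarrow> 0 \<le> f x"
    and x0: "x0 \<in> interior K" "0 < f x0"
  shows "0 < (\<integral>x. f x \<partial>lebesgue_on K)"
proof -
  have int: "integrable (lebesgue_on K) f"
    by (rule integrable_continuous_lebesgue_on[OF assms(1-3)])
  have AE_nonneg: "AE x in lebesgue_on K. 0 \<le> f x"
    using nonneg by (intro AE_I2) (simp add: space_restrict_space)
  have "(\<integral>x. f x \<partial>lebesgue_on K) \<noteq> 0"
  proof
    assume "(\<integral>x. f x \<partial>lebesgue_on K) = 0"
    then have "AE x in lebesgue_on K. f x = 0"
      using integral_nonneg_eq_0_iff_AE[OF int AE_nonneg] by simp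
    then have "AE x in lebesgue. x \<in> K \<longrightarrow> f x = 0"
      using assms(2) by (subst (asm) AE_restrict_space_iff) (auto simp: fmeasurableD)
    then have "negligible {x. \<not> (x \<in> K \<longrightarrow> f x = 0)}"
      by (simp add: AE_iff_null_sets negligible_iff_null_sets eventually_ae_filter)
         (metis (no_types, lifting) null_sets_completion_subset)
    moreover have "interior K \<inter> {x. 0 < f x} \<subseteq> {x. \<not> (x \<in> K \<longrightarrow> f x = 0)}"
      using interior_subset by auto
    ultimately have "negligible (interior K \<inter> {x. 0 < f x})"
      by (rule negligible_subset)
    moreover have "open (interior K \<inter> {x. 0 < f x})"
      using assms(3) by (intro open_Int open_Collect_less) auto
    ultimately show False
      using open_not_negligible x0 by blast
  qed
  with integral_nonneg_AE[OF AE_nonneg] show ?thesis by linarith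
qed

section \<open>Moments of the exponential family\<close>

locale convex_body =
  fixes K :: "(real ^ 'n) set"
  assumes bounded: "bounded K" and convex: "convex K" and interior: "interior K \<noteq> {}"
begin

abbreviation A :: "real ^ 'n \<Rightarrow> real" where "A \<equiv> log_partition K"

definition mean :: "real ^ 'n \<Rightarrow> real ^ 'n" where
  "mean \<eta> = (\<integral>x. x \<partial>exp_family K \<eta>)"

lemma lmeasurable: "K \<in> lmeasurable"
  using convex bounded by (rule measurable_convex)

lemma exp_log_partition: "exp (A \<eta>) = (\<integral>x. exp (- (\<eta> \<bullet> x)) \<partial>lebesgue_on K)"
proof -
  obtain x0 where "x0 \<in> interior K"
    using interior by blast
  then have "0 < (\<integral>x. exp (- (\<eta> \<bullet> x)) \<partial>lebesgue_on K)"
    by (intro integral_lebesgue_on_pos[OF bounded lmeasurable]) (auto intro!: continuous_intros)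
  \<comment> \<open>Positivity excludes the default value of \<open>ln\<close> at \<open>0\<close>.\<close>
  then show ?thesis
    by (simp add: log_partition_def)
qed

lemma
  fixes f :: "real ^ 'n \<Rightarrow> 'b::{banach, second_countable_topology}"
  assumes "continuous_on UNIV f"
  shows integrable_exp_family: "integrable (exp_family K \<eta>) f"
    and integral_exp_family:
      "(\<integral>x. f x \<partial>exp_family K \<eta>) = (\<integral>x. exp (- (\<eta> \<bullet> x) - A \<eta>) *\<^sub>R f x \<partial>lebesgue_on K)"
proof -
  have meas: "f \<in> borel_measurable (lebesgue_on K)"
    using assms lmeasurable
    by (intro borel_measurable_integrable integrable_continuous_lebesgue_on bounded)
  have dens: "(\<lambda>x. exp (- (\<eta> \<bullet> x) - A \<eta>)) \<in> borel_measurable (lebesgue_on K)"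
    by (intro borel_measurable_integrable integrable_continuous_lebesgue_on bounded lmeasurable
        continuous_intros)
  show "integrable (exp_family K \<eta>) f"
    unfolding exp_family_def
    using meas dens
    by (subst integrable_density)
       (auto intro!: integrable_continuous_lebesgue_on bounded lmeasurable continuous_intros assms)
  show "(\<integral>x. f x \<partial>exp_family K \<eta>) = (\<integral>x. exp (- (\<eta> \<bullet> x) - A \<eta>) *\<^sub>R f x \<partial>lebesgue_on K)"
    unfolding exp_family_def using meas dens by (subst integral_density) auto
qed

lemma integral_exp_family_mono:
  fixes f g :: "real ^ 'n \<Rightarrow> real"
  assumes "continuous_on UNIV f" "continuous_on UNIV g" "\<And>x. x \<in> K \<Longrightarrow> f x \<le> g x"
  shows "(\<integral>x. f x \<partial>exp_family K \<eta>) \<le> (\<integral>x. g x \<partial>exp_family K \<eta>)"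
  using assms
  by (intro integral_mono integrable_exp_family)
     (auto simp: exp_family_def space_restrict_space)

text \<open>
  Tilting \<open>P\<^sub>\<eta>\<close> by the exponential of a linear function gives another member of the family, up to
  the normalising constant.  The free centre \<open>c\<close> lets the same identity serve both halves of the
  subgradient argument.
\<close>

lemma exp_family_moment:
  "(\<integral>x. exp (- (w \<bullet> (x - c))) \<partial>exp_family K \<eta>) = exp (A (\<eta> + w) - A \<eta> + w \<bullet> c)"
proof -
  have "(\<integral>x. exp (- (w \<bullet> (x - c))) \<partial>exp_family K \<eta>)
      = (\<integral>x. exp (w \<bullet> c - A \<eta>) * exp (- ((\<eta> + w) \<bullet> x)) \<partial>lebesgue_on K)"
    by (subst integral_exp_family)
       (auto intro!: continuous_intros Bochner_Integration.integral_cong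
         simp: algebra_simps simp flip: exp_add)
  also have "\<dots> = exp (w \<bullet> c - A \<eta>) * exp (A (\<eta> + w))"
    by (simp add: exp_log_partition)
  also have "\<dots> = exp (A (\<eta> + w) - A \<eta> + w \<bullet> c)"
    by (simp add: algebra_simps flip: exp_add)
  finally show ?thesis .
qed

lemma integral_exp_family_const: "(\<integral>x. (k::real) \<partial>exp_family K \<eta>) = k"
proof -
  have "(\<integral>x. (1::real) \<partial>exp_family K \<eta>) = 1"
    using exp_family_moment[where w = 0] by simp
  then show ?thesis
    by simp
qed

lemma integral_exp_family_affine:
  "(\<integral>x. k + w \<bullet> (x - c) \<partial>exp_family K \<eta>) = k + w \<bullet> (mean \<eta> - c)"
proof -
  have "(\<integral>x. k + w \<bullet> (x - c) \<partial>exp_family K \<eta>) = (\<integral>x. (k - w \<bullet> c) + w \<bullet> x \<partial>exp_family K \<eta>)"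
    by (simp add: algebra_simps)
  also have "\<dots> = (\<integral>x. k - w \<bullet> c \<partial>exp_family K \<eta>) + (\<integral>x. w \<bullet> x \<partial>exp_family K \<eta>)"
    by (intro Bochner_Integration.integral_add integrable_exp_family continuous_intros)
  also have "(\<integral>x. w \<bullet> x \<partial>exp_family K \<eta>) = w \<bullet> mean \<eta>"
    unfolding mean_def
    by (intro integral_inner_right integrable_exp_family continuous_intros)
  finally show ?thesis
    by (simp only: integral_exp_family_const) (simp add: algebra_simps)
qed

section \<open>The mean as the unique subgradient\<close>

lemma mean_subgradient: "0 \<le> A (\<eta> + w) - A \<eta> + w \<bullet> mean \<eta>"
proof -
  have "1 = (\<integral>x. 1 + (- w) \<bullet> (x - mean \<eta>) \<partial>exp_family K \<eta>)"
    by (simp only: integral_exp_family_affine) simp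
  also have "\<dots> \<le> (\<integral>x. exp (- (w \<bullet> (x - mean \<eta>))) \<partial>exp_family K \<eta>)"
    using exp_ge_add_one_self
    by (intro integral_exp_family_mono continuous_intros) (metis inner_minus_left)
  also have "\<dots> = exp (A (\<eta> + w) - A \<eta> + w \<bullet> mean \<eta>)"
    by (rule exp_family_moment)
  finally show ?thesis by simp
qed

text \<open>
  This is differentiability of \<open>A\<close> in disguise.  Along \<open>w = s v\<close> with \<open>v = m - x\<close>, the linear term
  contributes \<open>- s \<parallel>v\<parallel>\<^sup>2\<close> to the exponential moment and the remainder is of order \<open>s\<^sup>2\<close>, so for small
  \<open>s\<close> the subgradient inequality fails unless \<open>v = 0\<close>.
\<close>

lemma subgradient_unique:
  assumes sub: "\<And>w. 0 \<le> A (\<eta> + w) - A \<eta> + w \<bullet> x"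
  shows "x = mean \<eta>"
proof (rule ccontr)
  assume "x \<noteq> mean \<eta>"
  define v where "v = mean \<eta> - x"
  define q where "q = v \<bullet> v"
  have q: "0 < q"
    using \<open>x \<noteq> mean \<eta>\<close> by (simp add: q_def v_def)
  obtain R where R: "\<And>y. y \<in> K \<Longrightarrow> norm y \<le> R"
    using bounded by (auto simp: bounded_iff)
  define C where "C = max q (norm v * (R + norm x))"
  have C: "\<bar>v \<bullet> (y - x)\<bar> \<le> C" if "y \<in> K" for y
  proof -
    have "\<bar>v \<bullet> (y - x)\<bar> \<le> norm v * norm (y - x)"
      by (rule Cauchy_Schwarz_ineq2)
    also have "\<dots> \<le> norm v * (R + norm x)"
      using R[OF that] norm_triangle_ineq4[of y x] by (intro mult_left_mono) auto
    finally show ?thesis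
      by (simp add: C_def)
  qed
  have "q \<le> C" "0 < C"
    using q by (auto simp: C_def)
  \<comment> \<open>The value of \<open>s\<close> at which \<open>s q - 2 s\<^sup>2 C\<^sup>2\<close> is largest; \<open>q \<le> C\<close> makes it admissible for
    the quadratic bound.\<close>
  define s where "s = q / (4 * C\<^sup>2)"
  have "0 < s"
    using q \<open>0 < C\<close> by (simp add: s_def)
  have sC: "s * C \<le> 1/2"
    using \<open>q \<le> C\<close> \<open>0 < C\<close> by (simp add: s_def power2_eq_square field_simps)
  have "1 \<le> exp (A (\<eta> + s *\<^sub>R v) - A \<eta> + (s *\<^sub>R v) \<bullet> x)"
    using sub[of "s *\<^sub>R v"] by simp
  also have "\<dots> = (\<integral>y. exp (- ((s *\<^sub>R v) \<bullet> (y - x))) \<partial>exp_family K \<eta>)"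
    by (rule exp_family_moment[symmetric])
  also have "\<dots> \<le> (\<integral>y. (1 + 2 * (s * C)\<^sup>2) + (- (s *\<^sub>R v)) \<bullet> (y - x) \<partial>exp_family K \<eta>)"
  proof (intro integral_exp_family_mono continuous_intros)
    fix y assume y: "y \<in> K"
    define z where "z = - ((s *\<^sub>R v) \<bullet> (y - x))"
    have "\<bar>z\<bar> \<le> s * C"
      using mult_left_mono[OF C[OF y], of s] \<open>0 < s\<close> by (simp add: z_def abs_mult)
    then have "z \<le> 1/2" "z\<^sup>2 \<le> (s * C)\<^sup>2"
      using sC by (auto simp: abs_le_square_iff[symmetric])
    then show "exp (- ((s *\<^sub>R v) \<bullet> (y - x))) \<le> (1 + 2 * (s * C)\<^sup>2) + (- (s *\<^sub>R v)) \<bullet> (y - x)"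
      using exp_le_quadratic[of z] by (simp add: z_def)
  qed
  also have "\<dots> = 1 + 2 * (s * C)\<^sup>2 - s * q"
    by (simp only: integral_exp_family_affine) (simp add: v_def q_def)
  finally have "s * q \<le> s * (2 * s * C\<^sup>2)"
    by (simp add: power2_eq_square mult_ac)
  then have "q \<le> 2 * s * C\<^sup>2"
    using \<open>0 < s\<close> by simp
  then show False
    using q \<open>0 < C\<close> by (simp add: s_def)
qed

text \<open>
  If \<open>a \<bullet> y \<le> b\<close> on \<open>K\<close> and \<open>b \<le> a \<bullet> m\<close>, then \<open>b - a \<bullet> X\<close> is nonnegative with nonpositive
  expectation.  The density is positive, so \<open>b - a \<bullet> X\<close> would vanish throughout the interior, which
  then would lie in a hyperplane.
\<close>

lemma mean_in_interior: "mean \<eta> \<in> interior K"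
proof (rule ccontr)
  assume "mean \<eta> \<notin> interior K"
  then obtain a b where a: "a \<noteq> 0" and le: "\<And>y. y \<in> interior K \<Longrightarrow> a \<bullet> y \<le> b" "b \<le> a \<bullet> mean \<eta>"
    using separating_hyperplane_sets[of "interior K" "{mean \<eta>}"] convex interior
    by (auto simp: convex_interior)
  have le_K: "a \<bullet> y \<le> b" if "y \<in> K" for y
  proof -
    have "K \<subseteq> closure (interior K)"
      using convex_closure_interior[OF convex interior] closure_subset by blast
    also have "\<dots> \<subseteq> {y. a \<bullet> y \<le> b}"
      using le by (intro closure_minimal closed_halfspace_le) auto
    finally show ?thesis
      using that by blast
  qed
  have "interior K \<inter> {y. a \<bullet> y < b} \<noteq> {}"
  proof
    assume "interior K \<inter> {y. a \<bullet> y < b} = {}"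
    then have "interior K \<subseteq> {y. a \<bullet> y = b}"
      using le(1) by force
    then have "interior K \<subseteq> interior {y. a \<bullet> y = b}"
      by (simp add: interior_maximal)
    with a interior show False
      by simp
  qed
  then obtain x0 where x0: "x0 \<in> interior K" "a \<bullet> x0 < b"
    by blast
  have "0 < (\<integral>y. exp (- (\<eta> \<bullet> y) - A \<eta>) *\<^sub>R (b + (- a) \<bullet> (y - 0)) \<partial>lebesgue_on K)"
    using x0 le_K
    by (intro integral_lebesgue_on_pos[OF bounded lmeasurable, where ?x0.0 = x0] continuous_intros)
       auto
  also have "\<dots> = (\<integral>y. b + (- a) \<bullet> (y - 0) \<partial>exp_family K \<eta>)"
    by (intro integral_exp_family[symmetric] continuous_intros)
  also have "\<dots> = b - a \<bullet> mean \<eta>"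
    by (simp only: integral_exp_family_affine) simp
  finally show False
    using le(2) by simp
qed

section \<open>Central path and heat path\<close>

lemma entropic_barrier_interior:
  assumes "x \<in> interior K"
  shows "entropic_barrier K x = (SUP \<xi>. ereal (- (\<xi> \<bullet> x) - A \<xi>))"
  using assms
  by (simp add: entropic_barrier_def log_partition_conjugate_def fenchel_conjugate_def
      interior_negations)

lemma central_objective_le_iff:
  assumes "x \<in> interior K"
  shows "central_objective (entropic_barrier K) \<theta> t x \<le> ereal k \<longleftrightarrow>
         (\<forall>\<xi>. t * (\<theta> \<bullet> x) - \<xi> \<bullet> x - A \<xi> \<le> k)"
proof -
  have "central_objective (entropic_barrier K) \<theta> t x \<le> ereal k \<longleftrightarrow>
      entropic_barrier K x \<le> ereal (k - t * (\<theta> \<bullet> x))"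
    unfolding central_objective_def by (cases "entropic_barrier K x") auto
  also have "\<dots> \<longleftrightarrow> (\<forall>\<xi>. - (\<xi> \<bullet> x) - A \<xi> \<le> k - t * (\<theta> \<bullet> x))"
    by (simp add: entropic_barrier_interior[OF assms] SUP_le_iff)
  finally show ?thesis
    by (auto simp: algebra_simps)
qed

lemma central_objective_ge:
  assumes "x \<in> interior K"
  shows "ereal (- A (t *\<^sub>R \<theta>)) \<le> central_objective (entropic_barrier K) \<theta> t x"
proof -
  have "ereal (- ((t *\<^sub>R \<theta>) \<bullet> x) - A (t *\<^sub>R \<theta>)) \<le> entropic_barrier K x"
    unfolding entropic_barrier_interior[OF assms] by (rule SUP_upper) simp
  then show ?thesis
    unfolding central_objective_def by (cases "entropic_barrier K x") auto
qed

text \<open>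
  The Fenchel--Young lower bound is attained exactly where \<open>- x\<close> is a subgradient of \<open>A\<close> at
  \<open>t \<theta>\<close>, that is, exactly at the mean.
\<close>

lemma central_objective_attains_iff:
  assumes "x \<in> interior K"
  shows "central_objective (entropic_barrier K) \<theta> t x \<le> ereal (- A (t *\<^sub>R \<theta>)) \<longleftrightarrow>
         x = mean (t *\<^sub>R \<theta>)"
proof -
  have "central_objective (entropic_barrier K) \<theta> t x \<le> ereal (- A (t *\<^sub>R \<theta>)) \<longleftrightarrow>
      (\<forall>\<xi>. 0 \<le> A \<xi> - A (t *\<^sub>R \<theta>) + (\<xi> - t *\<^sub>R \<theta>) \<bullet> x)"
    unfolding central_objective_le_iff[OF assms] by (simp add: algebra_simps)
  also have "\<dots> \<longleftrightarrow> (\<forall>w. 0 \<le> A (t *\<^sub>R \<theta> + w) - A (t *\<^sub>R \<theta>) + w \<bullet> x)"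
    by (metis add_diff_cancel_left' add.commute diff_add_cancel)
  also have "\<dots> \<longleftrightarrow> x = mean (t *\<^sub>R \<theta>)"
    using mean_subgradient subgradient_unique by blast
  finally show ?thesis .
qed

lemma is_arg_min_central_objective_iff:
  "is_arg_min (central_objective (entropic_barrier K) \<theta> t) (\<lambda>x. x \<in> interior K) x \<longleftrightarrow>
   x = mean (t *\<^sub>R \<theta>)"
proof
  assume min: "is_arg_min (central_objective (entropic_barrier K) \<theta> t) (\<lambda>x. x \<in> interior K) x"
  have "central_objective (entropic_barrier K) \<theta> t x
      \<le> central_objective (entropic_barrier K) \<theta> t (mean (t *\<^sub>R \<theta>))"
    using min mean_in_interior by (auto simp: is_arg_min_linorder)
  also have "\<dots> \<le> ereal (- A (t *\<^sub>R \<theta>))"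
    by (simp add: central_objective_attains_iff mean_in_interior)
  finally show "x = mean (t *\<^sub>R \<theta>)"
    using min by (simp add: central_objective_attains_iff is_arg_min_def)
next
  assume "x = mean (t *\<^sub>R \<theta>)"
  moreover have "central_objective (entropic_barrier K) \<theta> t (mean (t *\<^sub>R \<theta>))
      \<le> central_objective (entropic_barrier K) \<theta> t y" if "y \<in> interior K" for y
    using central_objective_attains_iff[OF mean_in_interior, of \<theta> t "t *\<^sub>R \<theta>"]
      central_objective_ge[OF that, of t \<theta>]
    by simp
  ultimately show "is_arg_min (central_objective (entropic_barrier K) \<theta> t) (\<lambda>x. x \<in> interior K) x"
    by (simp add: is_arg_min_linorder mean_in_interior)
qed

lemma central_path_eq_means:
  "central_path K (entropic_barrier K) \<theta> = (\<Union>t\<in>{0<..}. {mean (t *\<^sub>R \<theta>)})"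
  by (simp add: central_path_def arg_min_def is_arg_min_central_objective_iff)

text \<open>The temperature \<open>t\<close> on the heat path corresponds to the parameter \<open>1 / t\<close> on the central path.\<close>

lemma heat_path_eq_means: "heat_path K \<theta> = (\<Union>t\<in>{0<..}. {mean (t *\<^sub>R \<theta>)})"
proof -
  have "(\<Union>t\<in>{0<..}. {mean (t *\<^sub>R \<theta>)}) = (\<lambda>t. mean (t *\<^sub>R \<theta>)) ` inverse ` {0::real<..}"
  proof -
    have "inverse ` {0::real<..} = {0<..}"
      by (auto simp: image_iff intro!: bexI[of _ "inverse _"])
    then show ?thesis
      by auto
  qed
  then show ?thesis
    by (auto simp: heat_path_def mean_def)
qed

end

theorem corollary2:
  fixes K :: "(real ^ 'n) set" and \<theta> :: "real ^ 'n"
  assumes "bounded K" and "convex K" and "interior K \<noteq> {}"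
  shows "(\<forall>t>0. \<exists>!x. is_arg_min (central_objective (entropic_barrier K) \<theta> t)
                       (\<lambda>x. x \<in> interior K) x) \<and>
         heat_path K \<theta> = central_path K (entropic_barrier K) \<theta>"
proof -
  interpret convex_body K
    using assms by unfold_locales
  show ?thesis
    by (simp add: is_arg_min_central_objective_iff central_path_eq_means heat_path_eq_means)
qed

end
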